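(* Let $q\ge 2$ and let $k,t_1,\dots,t_q$ be integers with $2 \leq k < t_1, \dots, t_q$, and let $m = \tilde{r}_{k-1}(t_1-1, \dots, t_q-1)$. Then in the $q$-color $k$-uniform vertex online Ramsey game for cliques of sizes $t_1,\dots,t_q$, builder has a strategy that, against every painter strategy, forces for some $c\in[q]$ a copy of $K_{t_c}^{(k)}$ all of whose edges have color $c$, while revealing at most $q^m + k - 2$ vertices and building at most $m \cdot q^m$ edges. In particular, \[ r_k(t_1, \dots, t_q) \leq q^m + k - 2 \qquad\text{and}\qquad \tilde{r}_k(t_1, \dots, t_q) \leq q^{m + \log_q m}. \]
   Context: $K_n^{(k)}$ denotes the complete $k$-uniform hypergraph on $n$ vertices. For integers $k < t_1,\dots,t_q$, the Ramsey number $r_k(t_1,\dots,t_q)$ is the least $n$ such that every $q$-coloring of the edges of $K_n^{(k)}$ contains, for some color $c\in[q]$, a copy of $K_{t_c}^{(k)}$ all of whose edges have color $c$. The $q$-color $k$-uniform vertex online Ramsey game for cliques of sizes $t_1,\dots,t_q$ (with $k<t_1,\dots,t_q$) is played by builder and painter on an ordered vertex set $v_1,v_2,\dots$ of an initially empty $k$-uniform hypergraph, in rounds. At the start of round $i$ the vertex $v_i$ is revealed. During round $i$, builder may build any number of edges of the form $\{v_{i_1},\dots,v_{i_{k-1}},v_i\}$ with $i_1<\dots<i_{k-1}<i$, in any order (adaptively); whenever an edge is built, painter must immediately assign it a color from $[q]$. In each round $i\geq k$ builder must build at least one new edge. Builder's goal is to force, for some $c\in[q]$, a copy of $K_{t_c}^{(k)}$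 all of whose edges are built and have color $c$; painter tries to delay this. The $k$-uniform vertex online Ramsey number $\tilde{r}_k(t_1,\dots,t_q)$ is the minimum number of edges builder must build to force such a monochromatic clique against any painter strategy. These definitions are also used for uniformity $1$ (when $k=2$, the quantity $\tilde r_1$ appears). *)

theory Defs
  imports Complex_Main "HOL-Library.Ramsey"
begin

text \<open>
  Vertices are natural numbers: the vertex \<open>v\<^sub>i\<close> of the paper (\<open>i \<ge> 1\<close>) is \<open>i - 1\<close>, so that after
  \<open>n\<close> reveals the vertex set is \<open>{..<n}\<close>. The clique sizes \<open>t\<^sub>1, \<dots>, t\<^sub>q\<close> form a list \<open>ts\<close> with
  \<open>q = length ts\<close>, and the colors are \<open>{..<q}\<close>, following \<^const>\<open>partn_lst\<close>.
\<close>

definition ramsey_number :: "nat \<Rightarrow> nat list \<Rightarrow> nat" where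
  "ramsey_number k ts = (LEAST n. partn_lst {..<n} ts k)"


section \<open>The vertex online Ramsey game\<close>

datatype event = Revealed | Built "nat set" nat

text \<open>A history is the chronological list of everything that has happened so far, newest event last.\<close>

type_synonym history = "event list"

definition num_vertices :: "history \<Rightarrow> nat" where
  "num_vertices h = length (filter (\<lambda>x. x = Revealed) h)"

definition num_edges :: "history \<Rightarrow> nat" where
  "num_edges h = length (filter (\<lambda>x. x \<noteq> Revealed) h)"

text \<open>\<open>Reveal\<close> ends the current round, if any, and starts the next one.\<close>

datatype move = Reveal | Build "nat set"

type_synonym builder = "history \<Rightarrow> move"

type_synonym painter = "history \<Rightarrow> nat set \<Rightarrow> nat"

definition painter_strategy :: "nat \<Rightarrow> painter \<Rightarrow> bool" where
  "painter_strategy q \<pi> \<longleftrightarrow> (\<forall>h e. \<pi> h e < q)"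

text \<open>
  With \<open>n\<close> vertices revealed, round \<open>n\<close> is being played (\<open>n = 0\<close>: the game has not started) and its
  vertex is \<open>n - 1\<close>. The built edges containing this vertex are those built in the current round.
\<close>

fun legal_move :: "nat \<Rightarrow> history \<Rightarrow> move \<Rightarrow> bool" where
  "legal_move k h Reveal \<longleftrightarrow>
     num_vertices h < k \<or> (\<exists>e c. Built e c \<in> set h \<and> num_vertices h - 1 \<in> e)"
| "legal_move k h (Build e) \<longleftrightarrow>
     num_vertices h \<ge> 1 \<and> e \<in> [{..<num_vertices h}]\<^bsup>k\<^esup> \<and> num_vertices h - 1 \<in> e \<and>
     (\<forall>c. Built e c \<notin> set h)"

fun play :: "builder \<Rightarrow> painter \<Rightarrow> nat \<Rightarrow> history" where
  "play \<beta> \<pi> 0 = []"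
| "play \<beta> \<pi> (Suc s) =
     (let h = play \<beta> \<pi> s
      in h @ [case \<beta> h of Reveal \<Rightarrow> Revealed | Build e \<Rightarrow> Built e (\<pi> h e)])"

definition mono_clique :: "nat \<Rightarrow> nat list \<Rightarrow> history \<Rightarrow> bool" where
  "mono_clique k ts h \<longleftrightarrow>
     (\<exists>c<length ts. \<exists>S \<in> [{..<num_vertices h}]\<^bsup>(ts ! c)\<^esup>. \<forall>e \<in> [S]\<^bsup>k\<^esup>. Built e c \<in> set h)"

text \<open>
  Against every painter strategy, the builder strategy \<open>\<beta>\<close> reaches, by legal moves only, a history
  with a monochromatic clique that satisfies the additional condition \<open>P\<close> (a bound on its cost).
  What \<open>\<beta>\<close> would do after this point is irrelevant.
\<close>

definition builder_forces :: "nat \<Rightarrow> nat list \<Rightarrow> builder \<Rightarrow> (history \<Rightarrow> bool) \<Rightarrow> bool" where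
  "builder_forces k ts \<beta> P \<longleftrightarrow>
     (\<forall>\<pi>. painter_strategy (length ts) \<pi> \<longrightarrow>
        (\<exists>s. (\<forall>i<s. legal_move k (play \<beta> \<pi> i) (\<beta> (play \<beta> \<pi> i))) \<and>
             mono_clique k ts (play \<beta> \<pi> s) \<and> P (play \<beta> \<pi> s)))"

definition vertex_online_ramsey :: "nat \<Rightarrow> nat list \<Rightarrow> nat" where
  "vertex_online_ramsey k ts = (LEAST M. \<exists>\<beta>. builder_forces k ts \<beta> (\<lambda>h. num_edges h \<le> M))"

end

theory Submission
  imports Defs "HOL-Library.Sublist"
begin

text \<open>
  Let \<open>\<beta>\<close> win the \<open>(k - 1)\<close>-uniform game with \<open>m\<close> edges. The plays against \<open>\<beta>\<close> form a tree that
  branches over the colors at each \<open>Build\<close>. In the \<open>k\<close>-uniform game every new vertex \<open>w\<close> walks down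
  this tree: where \<open>\<beta>\<close> builds \<open>e\<close>, builder builds \<open>e \<union> {w}\<close> and \<open>w\<close> follows the color of this edge;
  where \<open>\<beta>\<close> reveals a vertex, \<open>w\<close> settles and plays the role of that vertex for all later walks, or
  walks on if another vertex has already settled there. Hence on the branch of \<open>w\<close> the color of
  an edge depends only on the edge without its last vertex, and when \<open>\<beta>\<close> has won, \<open>w\<close> extends the
  monochromatic clique of the smaller game. Since \<open>\<beta>\<close> must build an edge in each round, the nodes
  at which a vertex can settle after the first \<open>k - 1\<close> reveals are distinguished by their nonempty
  words of fewer than \<open>m\<close> colors, so there are at most \<open>q\<^sup>m - 2\<close> of them.
\<close>

section \<open>Histories, plays, and strategies obtained from an invariant\<close>

fun response :: "move \<Rightarrow> nat \<Rightarrow> event" where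
  "response Reveal c = Revealed"
| "response (Build e) c = Built e c"

lemma num_vertices_simps [simp]:
  "num_vertices [] = 0"
  "num_vertices (h @ h') = num_vertices h + num_vertices h'"
  "num_vertices (Revealed # h) = Suc (num_vertices h)"
  "num_vertices (Built e c # h) = num_vertices h"
  "num_vertices (replicate j Revealed) = j"
  by (simp_all add: num_vertices_def)

lemma num_edges_simps [simp]:
  "num_edges [] = 0"
  "num_edges (h @ h') = num_edges h + num_edges h'"
  "num_edges (Revealed # h) = num_edges h"
  "num_edges (Built e c # h) = Suc (num_edges h)"
  "num_edges (replicate j Revealed) = 0"
  by (simp_all add: num_edges_def)

lemma length_eq_vertices_plus_edges: "length h = num_vertices h + num_edges h"
  unfolding num_vertices_def num_edges_def by (induction h) auto

text \<open>A form without case split on the event: for \<open>Reveal\<close> the set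
  \<open>{}\<close> is a dummy, since \<open>response\<close> ignores the color.\<close>

lemma play_Suc:
  "play \<beta> \<pi> (Suc s) = play \<beta> \<pi> s @ [response (\<beta> (play \<beta> \<pi> s))
     (\<pi> (play \<beta> \<pi> s) (case \<beta> (play \<beta> \<pi> s) of Build e \<Rightarrow> e | Reveal \<Rightarrow> {}))]"
  by (simp add: Let_def split: move.split)

lemma length_play [simp]: "length (play \<beta> \<pi> s) = s"
  by (induction s) (auto simp: Let_def)

declare play.simps(2) [simp del]

lemma play_cong:
  assumes "\<And>h e. length h < s \<Longrightarrow> \<pi> h e = \<pi>' h e"
  shows "play \<beta> \<pi> s = play \<beta> \<pi>' s"
  using assms by (induction s) (auto simp: play.simps(2) Let_def split: move.split)

lemma builder_forces_mono:
  assumes "builder_forces k ts \<beta> P" and "\<And>h. P h \<Longrightarrow> Q h"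
  shows "builder_forces k ts \<beta> Q"
  using assms unfolding builder_forces_def by meson

text \<open>Builder picks at each history a legal move that keeps \<open>I\<close> whatever the
  painter answers. Every step lengthens the history, so the bound \<open>B\<close> on undecided
  histories makes the play end with a clique.\<close>

lemma builder_forces_from_invariant:
  assumes init: "I []"
    and step: "\<And>h. I h \<Longrightarrow> \<not> mono_clique k ts h \<Longrightarrow>
      \<exists>mv. legal_move k h mv \<and> (\<forall>c<length ts. I (h @ [response mv c]))"
    and bound: "\<And>h. I h \<Longrightarrow> \<not> mono_clique k ts h \<Longrightarrow> length h \<le> B"
  shows "\<exists>\<beta>. builder_forces k ts \<beta> I"
proof -
  let ?ok = "\<lambda>h mv. legal_move k h mv \<and> (\<forall>c<length ts. I (h @ [response mv c]))"
  define \<beta> where "\<beta> h = (SOME mv. ?ok h mv)" for h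
  have \<beta>: "?ok h (\<beta> h)" if "I h" "\<not> mono_clique k ts h" for h
    unfolding \<beta>_def by (rule someI_ex) (rule step[OF that])
  have "builder_forces k ts \<beta> I"
    unfolding builder_forces_def
  proof (intro allI impI)
    fix \<pi> assume \<pi>: "painter_strategy (length ts) \<pi>"
    let ?h = "play \<beta> \<pi>"
    have I: "I (?h s)" if "\<forall>i<s. \<not> mono_clique k ts (?h i)" for s
      using that
    proof (induction s)
      case 0
      then show ?case using init by simp
    next
      case (Suc s)
      then show ?case
        using \<beta>[of "?h s"] \<pi> unfolding play_Suc painter_strategy_def by simp
    qed
    have "\<exists>s. mono_clique k ts (?h s)"
    proof (rule ccontr)
      assume "\<nexists>s. mono_clique k ts (?h s)"
      then show False using I[of "Suc B"] bound[of "?h (Suc B)"] by simp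
    qed
    \<comment> \<open>At the first win all earlier histories are undecided, so \<open>I\<close> and
      legality are available up to \<open>s\<close>.\<close>
    then obtain s where s: "mono_clique k ts (?h s)" "\<forall>i<s. \<not> mono_clique k ts (?h i)"
      using exists_least_iff[of "\<lambda>s. mono_clique k ts (?h s)"] by blast
    have "legal_move k (?h i) (\<beta> (?h i))" if "i < s" for i
      using \<beta>[of "?h i"] I[of i] s(2) that by (meson less_trans)
    then show "\<exists>s. (\<forall>i<s. legal_move k (?h i) (\<beta> (?h i))) \<and> mono_clique k ts (?h s) \<and> I (?h s)"
      using s I by blast
  qed
  then show ?thesis by blast
qed

section \<open>Edges and cliques of a history\<close>

definition proper_edges :: "nat \<Rightarrow> history \<Rightarrow> bool" where
  "proper_edges k h \<longleftrightarrow> (\<forall>e c. Built e c \<in> set h \<longrightarrow> e \<in> [{..<num_vertices h}]\<^bsup>k\<^esup>)"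

lemma proper_edges_step:
  assumes "proper_edges k h" "legal_move k h mv"
  shows "proper_edges k (h @ [response mv c])"
  using assms by (cases mv) (force simp: proper_edges_def nsets_def)+

lemma proper_edges_play:
  assumes "\<forall>i<s. legal_move k (play \<beta> \<pi> i) (\<beta> (play \<beta> \<pi> i))"
  shows "proper_edges k (play \<beta> \<pi> s)"
  using assms
proof (induction s)
  case 0
  then show ?case by (simp add: proper_edges_def)
next
  case (Suc s)
  then show ?case unfolding play_Suc by (intro proper_edges_step) auto
qed

lemma mono_clique_has_edge:
  assumes "mono_clique k ts h" "\<forall>t\<in>set ts. k < t"
  shows "\<exists>e c. Built e c \<in> set h"
proof -
  obtain c S where "c < length ts" "S \<in> [{..<num_vertices h}]\<^bsup>(ts ! c)\<^esup>"
    and e: "\<forall>e \<in> [S]\<^bsup>k\<^esup>. Built e c \<in> set h"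
    using assms(1) unfolding mono_clique_def by blast
  then have "k \<le> card S" using assms(2) by (auto simp: nsets_def dest!: nth_mem)
  then obtain e where "e \<subseteq> S" "card e = k" "finite e" by (meson obtain_subset_with_card_n)
  then show ?thesis using e by (auto simp: nsets_def)
qed

text \<open>A vertex that has just been revealed lies on no edge, so it is in no monochromatic clique.\<close>

lemma mono_clique_Revealed:
  assumes "mono_clique k ts (h @ [Revealed])" "proper_edges k h" "0 < k" "\<forall>t\<in>set ts. k < t"
  shows "mono_clique k ts h"
proof -
  let ?n = "num_vertices h"
  obtain c S where c: "c < length ts" and S: "S \<in> [{..<Suc ?n}]\<^bsup>(ts ! c)\<^esup>"
    and e: "\<forall>e \<in> [S]\<^bsup>k\<^esup>. Built e c \<in> set h"
    using assms(1) unfolding mono_clique_def by auto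
  have "?n \<notin> S"
  proof
    assume n: "?n \<in> S"
    \<comment> \<open>With \<open>k - 1\<close> other members of \<open>S\<close> the new vertex
      would form an edge of \<open>h\<close>.\<close>
    have "k - 1 \<le> card (S - {?n})"
      using S c assms(4) n by (auto simp: nsets_def dest!: nth_mem)
    then obtain e' where e': "e' \<subseteq> S - {?n}" "card e' = k - 1" "finite e'"
      by (meson obtain_subset_with_card_n)
    then have "insert ?n e' \<in> [S]\<^bsup>k\<^esup>"
      using n assms(3) by (auto simp: nsets_def card_insert_if)
    then show False using e assms(2) unfolding proper_edges_def nsets_def by blast
  qed
  then have "S \<in> [{..<?n}]\<^bsup>(ts ! c)\<^esup>"
    using S by (auto simp: nsets_def less_Suc_eq)
  then show ?thesis using c e unfolding mono_clique_def by blast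
qed

section \<open>The tree of plays of the smaller game\<close>

text \<open>Here \<open>k\<close> is the uniformity of the smaller game; the game to be won has uniformity \<open>Suc k\<close>.\<close>

locale forced_game =
  fixes k m :: nat and ts :: "nat list" and \<beta> :: builder
  assumes k_pos: "0 < k" and sizes: "\<forall>t\<in>set ts. k < t" and two_colors: "2 \<le> length ts"
    and forces: "builder_forces k ts \<beta> (\<lambda>h. num_edges h \<le> m)"
begin

abbreviation "won \<equiv> mono_clique k ts"

text \<open>The histories reachable in the smaller game under arbitrary answers. Won histories are
  leaves, because nothing is known about \<open>\<beta>\<close> after its win.\<close>

inductive node :: "history \<Rightarrow> bool" where
  start: "node []"
| step: "node x \<Longrightarrow> \<not> won x \<Longrightarrow> c < length ts \<Longrightarrow> node (x @ [response (\<beta> x) c])"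

lemma node_Reveal: "node x \<Longrightarrow> \<not> won x \<Longrightarrow> \<beta> x = Reveal \<Longrightarrow> node (x @ [Revealed])"
  using node.step[of x 0] two_colors by fastforce

lemma node_Build:
  "node x \<Longrightarrow> \<not> won x \<Longrightarrow> \<beta> x = Build e \<Longrightarrow> c < length ts \<Longrightarrow> node (x @ [Built e c])"
  using node.step[of x c] by simp

text \<open>\<open>forces\<close> speaks of plays against a fixed painter, so each node must come
  from one. Changing the painter at the history \<open>x\<close> alone selects any child of
  \<open>x\<close> and leaves the play up to \<open>x\<close> intact.\<close>

lemma node_is_play:
  assumes "node x"
  shows "\<exists>\<pi>. painter_strategy (length ts) \<pi> \<and> play \<beta> \<pi> (length x) = x \<and>
    (\<forall>i<length x. \<not> won (play \<beta> \<pi> i))"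
  using assms
proof induction
  case start
  then show ?case
    using two_colors by (intro exI[of _ "\<lambda>_ _. 0"]) (auto simp: painter_strategy_def)
next
  case (step x c)
  then obtain \<pi> where \<pi>: "painter_strategy (length ts) \<pi>" "play \<beta> \<pi> (length x) = x"
    "\<forall>i<length x. \<not> won (play \<beta> \<pi> i)" by blast
  define \<pi>' where "\<pi>' h e = (if h = x then c else \<pi> h e)" for h e
  have same: "play \<beta> \<pi>' i = play \<beta> \<pi> i" if "i \<le> length x" for i
    using that by (intro play_cong) (auto simp: \<pi>'_def)
  have "painter_strategy (length ts) \<pi>'"
    using \<pi>(1) step.hyps by (auto simp: painter_strategy_def \<pi>'_def)
  moreover have "play \<beta> \<pi>' (Suc (length x)) = x @ [response (\<beta> x) c]"
    using same[of "length x"] \<pi>(2) by (simp add: play_Suc \<pi>'_def)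
  moreover have "\<forall>i<Suc (length x). \<not> won (play \<beta> \<pi>' i)"
    using \<pi>(2,3) same step.hyps by (auto simp: less_Suc_eq)
  ultimately show ?case by auto
qed

text \<open>Some play through \<open>x\<close> wins later with at most \<open>m\<close> edges. A
  reveal completes no clique, so at least one edge is built after \<open>x\<close>.\<close>

lemma node_not_won:
  assumes "node x" "\<not> won x"
  shows node_legal: "legal_move k x (\<beta> x)" and node_edges_less: "num_edges x < m"
proof -
  obtain \<pi> where \<pi>: "painter_strategy (length ts) \<pi>" "play \<beta> \<pi> (length x) = x"
    "\<forall>i<length x. \<not> won (play \<beta> \<pi> i)" using node_is_play[OF assms(1)] by blast
  let ?h = "play \<beta> \<pi>"
  obtain s where s: "\<forall>i<s. legal_move k (?h i) (\<beta> (?h i))" "won (?h s)" "num_edges (?h s) \<le> m"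
    using forces \<pi>(1) unfolding builder_forces_def by blast
  have "length x < s"
    using s(2) \<pi>(2,3) assms(2) by (metis linorder_neqE_nat)
  then show "legal_move k x (\<beta> x)" using s(1) \<pi>(2) by metis
  \<comment> \<open>Stated for every winning time \<open>s'\<close>, so that the induction can step
    back over a final reveal.\<close>
  have "num_edges x < num_edges (?h s')" if "length x \<le> s'" "s' \<le> s" "won (?h s')" for s'
    using that
  proof (induction s' rule: dec_induct)
    case base
    then show ?case using \<pi>(2) assms(2) by simp
  next
    case (step i)
    have le: "num_edges x \<le> num_edges (?h i)" if "length x \<le> i" for i
      using that by (induction i rule: dec_induct) (auto simp: \<pi>(2) play_Suc)
    show ?case
    proof (cases "\<beta> (?h i)")
      case Reveal
      have "proper_edges k (?h i)" using s(1) step.prems by (intro proper_edges_play) auto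
      then have "won (?h i)"
        using step.prems Reveal k_pos sizes by (auto simp: play_Suc intro: mono_clique_Revealed)
      then show ?thesis using step by (simp add: play_Suc)
    next
      case (Build e)
      then show ?thesis using le[of i] step.hyps by (simp add: play_Suc)
    qed
  qed
  from this[of s] show "num_edges x < m"
    using \<open>length x < s\<close> s(2,3) by simp
qed

lemma not_won_Nil: "\<not> won []"
  using mono_clique_has_edge[OF _ sizes, of "[]"] by auto

lemma m_pos: "0 < m"
  using node_edges_less[OF start not_won_Nil] by simp

lemma node_proper_edges: "node x \<Longrightarrow> proper_edges k x"
proof (induction rule: node.induct)
  case start
  then show ?case by (simp add: proper_edges_def)
next
  case (step x c)
  then show ?case using proper_edges_step node_legal by blast
qed

lemma node_edges_le: "node x \<Longrightarrow> num_edges x \<le> m"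
proof (induction rule: node.induct)
  case (step x c)
  then show ?case using node_edges_less[of x] by (cases "\<beta> x") auto
qed simp

lemma node_append:
  assumes "node (x @ a # y)"
  shows "node x \<and> \<not> won x \<and> (\<exists>c<length ts. a = response (\<beta> x) c)"
  using assms
proof (induction "x @ a # y" arbitrary: y rule: node.induct)
  case (step z c)
  then show ?case by (cases y rule: rev_cases) auto
qed simp

lemma node_not_won_Reveal:
  assumes "node x" "\<not> won x" "\<beta> x = Reveal" "k \<le> num_vertices x"
  shows "\<exists>e c. Built e c \<in> set x \<and> num_vertices x - 1 \<in> e"
  using node_legal[OF assms(1,2)] assms(3,4) by simp

definition root :: history where "root = replicate k Revealed"

text \<open>Fewer than \<open>k\<close> vertices carry no \<open>k\<close>-set, so
  \<open>\<beta>\<close> has to reveal; without edges nothing is won yet.\<close>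

lemma node_root: "node root"
proof -
  have "node (replicate j Revealed)" if "j \<le> k" for j
    using that
  proof (induction j)
    case 0
    then show ?case by (simp add: start)
  next
    case (Suc j)
    let ?x = "replicate j Revealed"
    have x: "node ?x" "\<not> won ?x"
      using Suc mono_clique_has_edge[OF _ sizes, of ?x] by auto
    have "\<beta> ?x = Reveal"
    proof (cases "\<beta> ?x")
      case (Build e)
      then have "e \<in> [{..<j}]\<^bsup>k\<^esup>" using node_legal[OF x] by simp
      then have "k \<le> j" unfolding nsets_def using card_mono[of "{..<j}" e] by auto
      then show ?thesis using Suc.prems by simp
    qed
    then show ?case
      using node_Reveal[OF x] by (simp add: replicate_append_same)
  qed
  then show ?thesis by (simp add: root_def)
qed

lemma root_simps [simp]:
  "num_vertices root = k" "num_edges root = 0" "Built e c \<notin> set root" "length root = k"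
  by (auto simp: root_def)

section \<open>Color words of nodes\<close>

fun color_of :: "event \<Rightarrow> nat list" where
  "color_of Revealed = []"
| "color_of (Built e c) = [c]"

text \<open>The branches taken on the way to a node. The reveals are forgotten;
  \<open>answers_inj\<close> recovers them.\<close>

definition answers :: "history \<Rightarrow> nat list" where
  "answers x = concat (map color_of x)"

lemma answers_simps [simp]:
  "answers (x @ y) = answers x @ answers y"
  "answers (Revealed # x) = answers x"
  "answers (Built e c # x) = c # answers x"
  by (auto simp: answers_def)

lemma length_answers: "length (answers x) = num_edges x"
proof (induction x)
  case (Cons a x)
  then show ?case by (cases a) (auto simp: num_edges_def)
qed (simp add: answers_def)

lemma set_answers: "node x \<Longrightarrow> set (answers x) \<subseteq> {..<length ts}"
proof (induction rule: node.induct)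
  case (step x c)
  then show ?case by (cases "\<beta> x") (auto simp: answers_def)
qed (simp add: answers_def)

text \<open>Two plays part only at a \<open>Build\<close>, through different colors. If instead one
  node extends the other by reveals alone, \<open>\<beta>\<close> cannot legally reveal again at the
  longer one, whose newest vertex lies on no edge yet.\<close>

lemma answers_inj:
  assumes y: "node y" "\<not> won y" "\<beta> y = Reveal" "k \<le> num_vertices y"
    and z: "node z" "\<not> won z" "\<beta> z = Reveal" "k \<le> num_vertices z"
    and eq: "answers y = answers z"
  shows "y = z"
proof -
  have no_prefix: "zs = []"
    if node: "node (y @ zs)" "\<not> won (y @ zs)" "\<beta> (y @ zs) = Reveal"
      and v: "k \<le> num_vertices (y @ zs)" and eq: "answers y = answers (y @ zs)" and y: "node y" for y zs
  proof (cases zs rule: rev_cases)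
    case (snoc zs' a)
    have "a = Revealed"
      using eq by (cases a) (auto simp: snoc)
    obtain e c where e: "Built e c \<in> set (y @ zs)" "num_vertices (y @ zs) - 1 \<in> e"
      using node_not_won_Reveal[OF node v] by blast
    have "proper_edges k (y @ zs')"
      using node(1) node_append[of "y @ zs'" a "[]"] by (intro node_proper_edges) (simp add: snoc)
    moreover have "Built e c \<in> set (y @ zs')"
      using e(1) by (auto simp: snoc \<open>a = Revealed\<close>)
    ultimately have "e \<in> [{..<num_vertices (y @ zs')}]\<^bsup>k\<^esup>"
      unfolding proper_edges_def by blast
    then have "e \<subseteq> {..<num_vertices (y @ zs')}" by (simp add: nsets_def)
    then have "e \<subseteq> {..<num_vertices (y @ zs) - 1}"
      by (simp add: snoc \<open>a = Revealed\<close>)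
    then show ?thesis using e(2) by auto
  qed simp
  consider "prefix y z" | "prefix z y" | "y \<parallel> z" by blast
  then show ?thesis
  proof cases
    case 1
    then show ?thesis using no_prefix[of y] y z eq by (auto simp: prefix_def)
  next
    case 2
    then show ?thesis using no_prefix[of z] y z eq by (auto simp: prefix_def)
  next
    case 3
    then obtain x a ys b zs where ab: "a \<noteq> b" "y = x @ a # ys" "z = x @ b # zs"
      using parallel_decomp by blast
    then obtain c d where "a = response (\<beta> x) c" "b = response (\<beta> x) d"
      using node_append y(1) z(1) by metis
    then show ?thesis using ab eq by (cases "\<beta> x") auto
  qed
qed

text \<open>
  \<open>T y\<close> is the vertex that has settled at the node \<open>y\<close>, \<open>E\<close> the set of events of the large game, and
  \<open>us ! i\<close> the vertex that plays the role of vertex \<open>i\<close> on the branch of \<open>x\<close>. Walks start at \<open>root\<close>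
  because every play begins with \<open>k\<close> reveals, where nothing branches.
\<close>

inductive walk :: "(history \<Rightarrow> nat option) \<Rightarrow> event set \<Rightarrow> nat \<Rightarrow> history \<Rightarrow> nat list \<Rightarrow> bool"
  for T E w where
  root: "walk T E w root [0..<k]"
| reveal: "walk T E w x us \<Longrightarrow> \<not> won x \<Longrightarrow> \<beta> x = Reveal \<Longrightarrow> T x = Some u \<Longrightarrow> u < w \<Longrightarrow>
    walk T E w (x @ [Revealed]) (us @ [u])"
| build: "walk T E w x us \<Longrightarrow> \<not> won x \<Longrightarrow> \<beta> x = Build e \<Longrightarrow> c < length ts \<Longrightarrow>
    Built (insert w ((!) us ` e)) c \<in> E \<Longrightarrow> walk T E w (x @ [Built e c]) us"

lemma walk_node: "walk T E w x us \<Longrightarrow> node x"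
  by (induction rule: walk.induct) (auto intro: node_root node_Reveal node_Build)

lemma walk_length: "walk T E w x us \<Longrightarrow> length us = num_vertices x"
  by (induction rule: walk.induct) auto

lemma walk_length_ge: "walk T E w x us \<Longrightarrow> k \<le> length x"
  by (induction rule: walk.induct) auto

lemma walk_vertices_ge: "walk T E w x us \<Longrightarrow> k \<le> num_vertices x"
  by (induction rule: walk.induct) auto

lemma walk_less: "walk T E w x us \<Longrightarrow> k \<le> w \<Longrightarrow> set us \<subseteq> {..<w}"
  by (induction rule: walk.induct) auto

text \<open>Later edges and settlements do not disturb earlier walks.\<close>

lemma walk_mono:
  assumes "walk T E w x us" "T \<subseteq>\<^sub>m T'" "E \<subseteq> E'"
  shows "walk T' E' w x us"
  using assms
proof (induction rule: walk.induct)
  case (reveal x us u)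
  then have "T' x = Some u" by (metis domI map_le_def)
  then show ?case using reveal by (intro walk.reveal) auto
qed (auto intro: walk.intros)

lemma walk_not_root: "walk T E w x us \<Longrightarrow> x @ [a] \<noteq> root"
  using walk_length_ge by (metis Suc_n_not_le_n length_append_singleton root_simps(4))

lemma walk_root: "walk T E w root us \<Longrightarrow> us = [0..<k]"
  by (erule walk.cases) (metis walk_not_root)+

text \<open>The labels are the initial ones followed by the vertices that \<open>T\<close> assigns
  to the reveal nodes on the branch, whoever walks. Hence a settled vertex and a later walker
  through its node see the same labels.\<close>

lemma walk_unique: "walk T E w x us \<Longrightarrow> walk T E' w' x us' \<Longrightarrow> us = us'"
proof (induction arbitrary: us' rule: walk.induct)
  case root
  then show ?case using walk_root by simp
next
  case (reveal x us u)
  from reveal.prems show ?case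
  proof cases
    case root
    then show ?thesis using walk_not_root[OF reveal.hyps(1)] by blast
  qed (use reveal in auto)
next
  case (build x us e c)
  from build.prems show ?case
  proof cases
    case root
    then show ?thesis using walk_not_root[OF build.hyps(1)] by blast
  qed (use build in auto)
qed

lemma nth_append_image:
  assumes "e \<subseteq> {..<length us}" shows "(!) (us @ vs) ` e = (!) us ` e"
  using assms by (intro image_cong) (auto simp: nth_append)

lemma walk_edge_subset:
  assumes "walk T E w x us" "Built e c \<in> set x"
  shows "e \<in> [{..<length us}]\<^bsup>k\<^esup>"
  using node_proper_edges[OF walk_node[OF assms(1)]] assms walk_length
  by (auto simp: proper_edges_def)

text \<open>An edge refers only to labels present when it was built, so appending labels does not
  change its image.\<close>

lemma walk_edge:
  "walk T E w x us \<Longrightarrow> Built e c \<in> set x \<Longrightarrow> Built (insert w ((!) us ` e)) c \<in> E"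
proof (induction rule: walk.induct)
  case (reveal x us u)
  then have "e \<subseteq> {..<length us}" using walk_edge_subset by (auto simp: nsets_def)
  then show ?case using reveal by (auto simp: nth_append_image)
qed auto

section \<open>Lifting the strategy\<close>

text \<open>The first \<open>k\<close> vertices are the labels at \<open>root\<close> and the newest
  vertex is still walking, so the settled vertices lie between them.\<close>

definition tree :: "history \<Rightarrow> (history \<Rightarrow> nat option) \<Rightarrow> bool" where
  "tree h T \<longleftrightarrow> (\<forall>y u. T y = Some u \<longrightarrow> k \<le> u \<and> u < num_vertices h - 1 \<and>
     (\<exists>us. walk T (set h) u y us) \<and> \<not> won y \<and> \<beta> y = Reveal)"

text \<open>The newest vertex stands at the free node \<open>x\<close>. Each vertex from
  \<open>k\<close> on builds one edge per edge on its branch, hence the formula for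
  \<open>num_edges h\<close>. The last condition ensures that the next edge of the walker is
  new.\<close>

definition position :: "history \<Rightarrow> (history \<Rightarrow> nat option) \<Rightarrow> history \<Rightarrow> nat list \<Rightarrow> bool" where
  "position h T x us \<longleftrightarrow>
     walk T (set h) (num_vertices h - 1) x us \<and> T x = None \<and> tree h T \<and>
     finite (dom T) \<and> num_vertices h = Suc (k + card (dom T)) \<and>
     num_edges h = (\<Sum>y\<in>dom T. num_edges y) + num_edges x \<and>
     proper_edges (Suc k) h \<and>
     (\<forall>e c. Built e c \<in> set h \<longrightarrow> num_vertices h - 1 \<in> e \<longrightarrow>
        (\<exists>e' c'. Built e' c' \<in> set x \<and> e = insert (num_vertices h - 1) ((!) us ` e')))"

lemma tree_step:
  assumes "tree h T" shows "tree (h @ h') T"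
proof -
  have "walk T (set (h @ h')) u y us" if "walk T (set h) u y us" for u y us
    using walk_mono[OF that] by auto
  then show ?thesis using assms unfolding tree_def by fastforce
qed

text \<open>Before it settled, \<open>us ! j\<close> walked down the same branch as
  \<open>w\<close>, so it too received the color \<open>c\<close> for \<open>e\<close>: the color
  does not depend on the last vertex.\<close>

lemma walk_edge_to_later_label:
  assumes "tree h T" "walk T (set h) w x us" "Built e c \<in> set x" "j < length us" "e \<subseteq> {..<j}"
  shows "Built (insert (us ! j) ((!) us ` e)) c \<in> set h"
  using assms(2-)
proof (induction rule: walk.induct)
  case (reveal x us u)
  have e: "Built e c \<in> set x" using reveal.prems by simp
  then have es: "e \<subseteq> {..<length us}"
    using walk_edge_subset[OF reveal.hyps(1)] by (auto simp: nsets_def)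
  show ?case
  proof (cases "j < length us")
    case True
    then show ?thesis using reveal e es by (simp add: nth_append_image) (simp add: nth_append)
  next
    case False
    \<comment> \<open>\<open>u\<close> settled at \<open>x\<close>, so its own walk led to
      \<open>x\<close>.\<close>
    obtain us' where us': "walk T (set h) u x us'"
      using assms(1) reveal.hyps unfolding tree_def by blast
    have "us' = us" using walk_unique us' reveal.hyps(1) by blast
    moreover have "(us @ [u]) ! j = u" using False reveal.prems(2) by (simp add: nth_append)
    ultimately show ?thesis
      using walk_edge[OF us' e] es by (simp add: nth_append_image)
  qed
next
  case (build x us e' c')
  show ?case
  proof (cases "e = e' \<and> c = c'")
    case True
    \<comment> \<open>The edge just built contains the last index, so no \<open>j\<close> lies above
      it.\<close>
    have "num_vertices x - 1 \<in> e"
      using node_legal[OF walk_node[OF build.hyps(1)] build.hyps(2)] build.hyps(3) True by simp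
    then show ?thesis using build.prems walk_length[OF build.hyps(1)] by auto
  next
    case False
    then show ?thesis using build by auto
  qed
qed simp

text \<open>A vertex settles at the end of a walk whose labels are all smaller. The strict order
  makes labels distinct, so images of index sets keep their size.\<close>

lemma walk_labels:
  assumes "tree h T" "walk T (set h) w x us" "k \<le> w"
  shows "sorted_wrt (<) us"
  using assms(2,3)
proof (induction rule: walk.induct)
  case (reveal x us u)
  then obtain us' where us': "walk T (set h) u x us'" "k \<le> u"
    using assms(1) unfolding tree_def by blast
  have "us' = us" using walk_unique us' reveal.hyps(1) by blast
  then show ?case using walk_less[OF us'] reveal by (auto simp: sorted_wrt_append)
qed auto

text \<open>The walker \<open>w\<close> joins the clique of the smaller game. A
  \<open>Suc k\<close>-subset containing \<open>w\<close> was built on the walk of \<open>w\<close>;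
  for any other, \<open>walk_edge_to_later_label\<close> applies to its last vertex.\<close>

lemma won_lift:
  assumes p: "position h T x us" and w: "won x"
  shows "mono_clique (Suc k) (map Suc ts) h"
proof -
  define w where "w = num_vertices h - 1"
  have walk: "walk T (set h) w x us" and tree: "tree h T" and kw: "k \<le> w" "w < num_vertices h"
    using p by (auto simp: position_def w_def)
  have less: "set us \<subseteq> {..<w}" using walk_less[OF walk kw(1)] .
  have srt: "sorted_wrt (<) us" using walk_labels[OF tree walk kw(1)] .
  have inj: "inj_on ((!) us) {..<length us}"
    using srt by (auto simp: inj_on_nth strict_sorted_iff)
  obtain c S where c: "c < length ts" and S: "S \<in> [{..<num_vertices x}]\<^bsup>(ts ! c)\<^esup>"
    and clique: "\<forall>e \<in> [S]\<^bsup>k\<^esup>. Built e c \<in> set x"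
    using w unfolding mono_clique_def by blast
  have S': "S \<subseteq> {..<length us}" "finite S" "card S = ts ! c"
    using S walk_length[OF walk] by (auto simp: nsets_def)
  have injS: "inj_on ((!) us) S" using inj S'(1) inj_on_subset by blast
  have sub: "(!) us ` S \<subseteq> {..<w}" using less S'(1) by (force dest: nth_mem)
  let ?S = "insert w ((!) us ` S)"
  have "?S \<in> [{..<num_vertices h}]\<^bsup>(map Suc ts ! c)\<^esup>"
  proof -
    have "w \<notin> (!) us ` S" using sub by auto
    then have "card ?S = Suc (ts ! c)"
      using S' card_image[OF injS] by simp
    then show ?thesis using sub kw(2) c S' by (auto simp: nsets_def)
  qed
  moreover have "Built f c \<in> set h" if f: "f \<in> [?S]\<^bsup>(Suc k)\<^esup>" for f
  proof -
    define F where "F = {i\<in>S. us ! i \<in> f}"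
    have F: "F \<subseteq> S" "finite F" using S' by (auto simp: F_def)
    have fF: "f - {w} = (!) us ` F" using f sub by (auto simp: F_def nsets_def)
    have card: "card (f - {w}) = card F"
      unfolding fF using F injS by (intro card_image) (rule inj_on_subset)
    have fin: "finite f" "card f = Suc k" using f by (auto simp: nsets_def)
    show ?thesis
    proof (cases "w \<in> f")
      case True
      then have "card F = k" using card fin by simp
      then have "Built F c \<in> set x" using clique F by (auto simp: nsets_def)
      from walk_edge[OF walk this] show ?thesis using True fF by (metis insert_Diff)
    next
      case False
      then have cF: "card F = Suc k" using card fin by simp
      \<comment> \<open>The vertex of largest index takes the part of \<open>w\<close>; the other
        \<open>k\<close> indices form an edge of the small clique.\<close>
      define j where "j = Max F"
      have "F \<noteq> {}" using cF by auto
      then have j: "j \<in> F" "F - {j} \<subseteq> {..<j}"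
        using F(2) unfolding j_def by (auto simp: le_neq_implies_less)
      have "card (F - {j}) = k" using cF j(1) by simp
      then have "F - {j} \<in> [S]\<^bsup>k\<^esup>" using F by (auto simp: nsets_def)
      then have "Built (F - {j}) c \<in> set x" using clique by blast
      from walk_edge_to_later_label[OF tree walk this _ j(2)]
      have "Built (insert (us ! j) ((!) us ` (F - {j}))) c \<in> set h" using j(1) F(1) S'(1) by auto
      moreover have "insert (us ! j) ((!) us ` (F - {j})) = f"
        using fF False j(1) by auto
      ultimately show ?thesis by simp
    qed
  qed
  ultimately show ?thesis
    unfolding mono_clique_def using c by (intro exI[of _ c] conjI bexI[of _ ?S]) simp_all
qed

text \<open>The walker passes occupied nodes until a free one. Each node passed becomes shorter than
  the current history, and only finitely many are occupied.\<close>

lemma walk_settle: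
  assumes "walk T E w x us" "finite (dom T)" "\<forall>y u. T y = Some u \<longrightarrow> u < w \<and> \<not> won y \<and> \<beta> y = Reveal"
  shows "\<exists>j vs. walk T E w (x @ replicate j Revealed) (us @ vs) \<and> T (x @ replicate j Revealed) = None"
  using assms(1)
proof (induction "card {y\<in>dom T. length x \<le> length y}" arbitrary: x us rule: less_induct)
  case less
  show ?case
  proof (cases "T x")
    case None
    then show ?thesis using less.prems by (intro exI[of _ 0] exI[of _ "[]"]) simp
  next
    case (Some u)
    let ?x = "x @ [Revealed]"
    have walk: "walk T E w ?x (us @ [u])"
      using less.prems Some assms(3) by (intro walk.reveal) auto
    have "{y\<in>dom T. length ?x \<le> length y} \<subset> {y\<in>dom T. length x \<le> length y}"
      using Some by force
    then have "card {y\<in>dom T. length ?x \<le> length y} < card {y\<in>dom T. length x \<le> length y}"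
      using assms(2) by (intro psubset_card_mono) auto
    from less.hyps[OF this walk] obtain j vs
      where "walk T E w (?x @ replicate j Revealed) ((us @ [u]) @ vs)"
        "T (?x @ replicate j Revealed) = None" by blast
    then show ?thesis
      by (intro exI[of _ "Suc j"] exI[of _ "u # vs"]) simp
  qed
qed

section \<open>Bounds on vertices and edges\<close>

lemma tree_node:
  assumes "tree h T" "y \<in> dom T"
  shows "node y" "\<not> won y" "\<beta> y = Reveal" "k \<le> num_vertices y"
proof -
  obtain u us where "walk T (set h) u y us" "\<not> won y" "\<beta> y = Reveal"
    using assms unfolding tree_def by (meson domD)
  then show "node y" "\<not> won y" "\<beta> y = Reveal" "k \<le> num_vertices y"
    using walk_node walk_vertices_ge by simp_all
qed

lemma position_card_tree:
  assumes p: "position h T x us"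
  shows "card (dom T) + 2 \<le> length ts ^ m"
proof -
  let ?q = "length ts"
  let ?A = "{as. set as \<subseteq> {..<?q} \<and> length as \<le> m - 1}"
  have "tree h T" using p by (simp add: position_def)
  note y = tree_node[OF this]
  have "inj_on answers (dom T)" using answers_inj y by (intro inj_onI) metis
  have fin: "finite (dom T)" using p by (simp add: position_def)
  \<comment> \<open>At least \<open>k\<close> vertices are revealed at \<open>z\<close>, so a legal
    \<open>Reveal\<close> there presupposes an edge, hence a color.\<close>
  have ne: "[] \<notin> answers ` dom T"
  proof
    assume "[] \<in> answers ` dom T"
    then obtain z where z: "z \<in> dom T" "answers z = []" by (metis imageE)
    then obtain e c where "Built e c \<in> set z" using node_not_won_Reveal[OF y] by blast
    then show False using z(2) by (force simp: answers_def)
  qed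
  \<comment> \<open>The empty word, taken by no node, gives one of the two units in the claim; the
    strict bound on the geometric sum gives the other.\<close>
  have "insert [] (answers ` dom T) \<subseteq> ?A"
    using y set_answers node_edges_less by (fastforce simp: length_answers)
  then have "card (insert [] (answers ` dom T)) \<le> card ?A"
    by (intro card_mono finite_lists_length_le) auto
  then have "Suc (card (dom T)) \<le> (\<Sum>i\<le>m - 1. ?q ^ i)"
    using fin ne \<open>inj_on answers (dom T)\<close> by (simp add: card_lists_length_le card_image)
  also have "\<dots> < ?q ^ m"
  proof -
    have "(\<Sum>i\<le>n. ?q ^ i) < ?q ^ Suc n" for n
    proof (induction n)
      case (Suc n)
      have "2 * ?q ^ Suc n \<le> ?q ^ Suc (Suc n)"
        unfolding power_Suc[of ?q "Suc n"] by (rule mult_right_mono[OF two_colors]) simp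
      moreover have "(\<Sum>i\<le>Suc n. ?q ^ i) < 2 * ?q ^ Suc n" using Suc.IH by simp
      ultimately show ?case by linarith
    qed (use two_colors in auto)
    from this[of "m - 1"] show ?thesis using m_pos by simp
  qed
  finally show ?thesis by simp
qed

text \<open>There are \<open>k\<close> initial vertices, one walker and at most
  \<open>length ts ^ m - 2\<close> settled vertices; the walker and each settled vertex account for
  at most \<open>m\<close> edges.\<close>

lemma position_bounds:
  assumes p: "position h T x us"
  shows "num_vertices h \<le> length ts ^ m + k - 1 \<and> num_edges h \<le> m * length ts ^ m"
proof
  have c: "card (dom T) + 2 \<le> length ts ^ m" by (rule position_card_tree[OF p])
  then show "num_vertices h \<le> length ts ^ m + k - 1" using p by (simp add: position_def)
  have "num_edges y \<le> m" if "y \<in> dom T" for y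
    using that p by (auto simp: position_def intro: node_edges_le tree_node)
  then have "(\<Sum>y\<in>dom T. num_edges y) \<le> card (dom T) * m"
    using sum_bounded_above[of "dom T" num_edges m] by simp
  moreover have "num_edges x \<le> m"
    using p by (auto simp: position_def intro: node_edges_le walk_node)
  ultimately have "num_edges h \<le> m * (card (dom T) + 1)"
    using p by (simp add: position_def algebra_simps)
  also have "\<dots> \<le> m * length ts ^ m" using c by (intro mult_left_mono) auto
  finally show "num_edges h \<le> m * length ts ^ m" .
qed

section \<open>Builder's moves in the larger game\<close>

text \<open>Were \<open>f\<close> already built, it would come from an edge of the branch; distinct
  labels make that edge \<open>e\<close> itself, which \<open>\<beta>\<close> may not
  repeat.\<close>

lemma position_Build:
  assumes p: "position h T x us" and "\<not> won x" and b: "\<beta> x = Build e"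
  defines "f \<equiv> insert (num_vertices h - 1) ((!) us ` e)"
  shows "legal_move (Suc k) h (Build f)"
    and "c < length ts \<Longrightarrow> \<exists>x' us'. position (h @ [Built f c]) T x' us'"
proof -
  define w where "w = num_vertices h - 1"
  have walk: "walk T (set h) w x us" and tree: "tree h T" and kw: "k \<le> w" "num_vertices h = Suc w"
    using p by (auto simp: position_def w_def)
  have less: "set us \<subseteq> {..<w}" using walk_less[OF walk kw(1)] .
  have inj: "inj_on ((!) us) {..<length us}"
    using walk_labels[OF tree walk kw(1)] by (auto simp: inj_on_nth strict_sorted_iff)
  have e: "e \<subseteq> {..<length us}" "finite e" "card e = k" "Built e c \<notin> set x" for c
    using node_legal[OF walk_node[OF walk] assms(2)] b walk_length[OF walk]
    by (auto simp: nsets_def)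
  have sub: "(!) us ` e \<subseteq> {..<w}" if "e \<subseteq> {..<length us}" for e
    using less that by (force dest: nth_mem)
  have "card ((!) us ` e) = k"
    using e card_image[OF inj_on_subset[OF inj e(1)]] by simp
  moreover have w: "w \<notin> (!) us ` e'" if "e' \<subseteq> {..<length us}" for e' using sub[OF that] by auto
  ultimately have f: "f \<in> [{..<Suc w}]\<^bsup>(Suc k)\<^esup>" "w \<in> f"
    using sub[OF e(1)] e(1,2) by (auto simp: f_def nsets_def kw(2) less_Suc_eq)
  have "Built f c \<notin> set h" for c
  proof
    assume "Built f c \<in> set h"
    then obtain e' c' where e': "Built e' c' \<in> set x" "f = insert w ((!) us ` e')"
      using p f(2) unfolding position_def w_def by blast
    have sub': "e' \<subseteq> {..<length us}"
      using walk_edge_subset[OF walk e'(1)] by (auto simp: nsets_def)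
    have "(!) us ` e' = (!) us ` e"
      using e'(2) insert_ident[OF w[OF sub'] w[OF e(1)]] unfolding f_def w_def[symmetric] by simp
    then have "e' = e" using inj_on_image_eq_iff[OF inj sub' e(1)] by blast
    then show False using e'(1) e(4) by blast
  qed
  then show legal: "legal_move (Suc k) h (Build f)"
    using f kw by simp
  show "\<exists>x' us'. position (h @ [Built f c]) T x' us'" if c: "c < length ts"
  proof -
    let ?h = "h @ [Built f c]" and ?x = "x @ [Built e c]"
    have tree': "tree ?h T" using tree_step[OF tree] .
    have "walk T (set ?h) w ?x us"
      using walk_mono[OF walk, of T "set ?h"] assms(2) b c
      by (intro walk.build) (auto simp: f_def w_def)
    moreover have fin: "finite (dom T)" using p by (simp add: position_def)
    ultimately obtain j vs where walk': "walk T (set ?h) w (?x @ replicate j Revealed) (us @ vs)"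
      and None: "T (?x @ replicate j Revealed) = None"
      using walk_settle[of T "set ?h" w ?x us] tree unfolding tree_def kw(2) by auto
    \<comment> \<open>The labels \<open>vs\<close>, gathered while passing occupied nodes, lie
      beyond the indices used by these edges.\<close>
    have img: "(!) (us @ vs) ` e' = (!) us ` e'" if "Built e' c' \<in> set x \<or> e' = e" for e' c'
      using that walk_edge_subset[OF walk, of e' c'] e(1)
      by (intro nth_append_image) (auto simp: nsets_def)
    have w_edges: "\<exists>e' c'. Built e' c' \<in> set (?x @ replicate j Revealed) \<and> g = insert w ((!) (us @ vs) ` e')"
      if g: "Built g d \<in> set ?h" "w \<in> g" for g d
    proof (cases "Built g d \<in> set h")
      case True
      then obtain e' c' where "Built e' c' \<in> set x" "g = insert w ((!) us ` e')"
        using p g unfolding position_def w_def by blast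
      then show ?thesis using img[of e' c'] by (intro exI[of _ e'] exI[of _ c']) auto
    next
      case False
      then have "g = f" using g by auto
      then show ?thesis
        using img[of e] by (intro exI[of _ e] exI[of _ c]) (auto simp: f_def w_def)
    qed
    have "proper_edges (Suc k) ?h"
      using proper_edges_step[OF _ legal, of c] p by (simp add: position_def del: legal_move.simps)
    moreover have "num_vertices ?h = Suc (k + card (dom T))"
      "num_edges ?h = (\<Sum>y\<in>dom T. num_edges y) + num_edges (?x @ replicate j Revealed)"
      using p by (simp_all add: position_def)
    moreover have "num_vertices ?h - 1 = w" by (simp add: w_def)
    ultimately have "position ?h T (?x @ replicate j Revealed) (us @ vs)"
      unfolding position_def using walk' None tree' fin w_edges by metis
    then show ?thesis by blast
  qed
qed

text \<open>A new vertex has no edges yet, and the reveals it passes after \<open>root\<close>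
  contribute none.\<close>

lemma position_at_root:
  assumes "tree h T" "finite (dom T)" "num_vertices h = Suc (k + card (dom T))"
    and "num_edges h = (\<Sum>y\<in>dom T. num_edges y)" "proper_edges (Suc k) h"
    and "\<forall>e c. Built e c \<in> set h \<longrightarrow> num_vertices h - 1 \<notin> e"
  shows "\<exists>x us. position h T x us"
proof -
  let ?w = "num_vertices h - 1"
  obtain j vs where "walk T (set h) ?w (root @ replicate j Revealed) ([0..<k] @ vs)"
    "T (root @ replicate j Revealed) = None"
    using walk_settle[OF walk.root[of T "set h" ?w] assms(2)] assms(1) unfolding tree_def by auto
  then have "position h T (root @ replicate j Revealed) ([0..<k] @ vs)"
    using assms unfolding position_def by auto
  then show ?thesis by blast
qed

text \<open>The smaller game has an edge at \<open>x\<close>, whose lift is an edge at the walker,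
  so the round may end. The walker settles at \<open>x\<close>, its edges enter the sum over
  \<open>dom T\<close>, and the next vertex starts at \<open>root\<close>.\<close>

lemma position_Reveal:
  assumes p: "position h T x us" and "\<not> won x" and b: "\<beta> x = Reveal"
  shows "legal_move (Suc k) h Reveal" and "\<exists>T' x' us'. position (h @ [Revealed]) T' x' us'"
proof -
  define w where "w = num_vertices h - 1"
  have walk: "walk T (set h) w x us" and tree: "tree h T" and kw: "k \<le> w" "num_vertices h = Suc w"
    and proper: "proper_edges (Suc k) h" and fin: "finite (dom T)" and None: "T x = None"
    using p by (auto simp: position_def w_def)
  obtain e c where "Built e c \<in> set x"
    using node_not_won_Reveal[OF walk_node[OF walk] assms(2) b walk_vertices_ge[OF walk]] by blast
  from walk_edge[OF walk this] show "legal_move (Suc k) h Reveal"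
    using kw by auto
  let ?h = "h @ [Revealed]" and ?T = "T(x \<mapsto> w)"
  have walk': "walk ?T (set ?h) u y us" if "walk T (set h) u y us" for u y us
  proof (rule walk_mono[OF that])
    show "T \<subseteq>\<^sub>m ?T" using None by (auto simp: map_le_def)
  qed auto
  have "tree ?h ?T"
    unfolding tree_def
  proof (intro allI impI)
    fix y u assume y: "?T y = Some u"
    have w: "num_vertices ?h - 1 = Suc w" using kw(2) by simp
    show "k \<le> u \<and> u < num_vertices ?h - 1 \<and> (\<exists>us. walk ?T (set ?h) u y us) \<and> \<not> won y \<and> \<beta> y = Reveal"
    proof (cases "y = x")
      case True
      moreover have "u = w" using y True by simp
      ultimately show ?thesis
        unfolding w using walk'[OF walk] kw(1) assms(2) b by blast
    next
      case False
      then have "T y = Some u" using y by simp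
      then obtain us where us: "walk T (set h) u y us" and "k \<le> u" "u < w" "\<not> won y" "\<beta> y = Reveal"
        using tree unfolding tree_def w_def by metis
      then show ?thesis
        unfolding w using walk'[OF us] less_SucI by blast
    qed
  qed
  moreover have "x \<notin> dom T" using None by auto
  moreover have "proper_edges (Suc k) ?h"
    using proper_edges_step[OF proper, of Reveal] \<open>legal_move (Suc k) h Reveal\<close> by simp
  moreover have "\<forall>e c. Built e c \<in> set ?h \<longrightarrow> num_vertices ?h - 1 \<notin> e"
    using proper by (auto simp: proper_edges_def nsets_def)
  ultimately have "\<exists>x' us'. position ?h ?T x' us'"
    using fin p by (intro position_at_root) (auto simp: position_def)
  then show "\<exists>T' x' us'. position ?h T' x' us'" by blast
qed

lemma builder_forces_Suc:
  "\<exists>\<beta>'. builder_forces (Suc k) (map Suc ts) \<beta>'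
     (\<lambda>h. num_vertices h \<le> length ts ^ m + k - 1 \<and> num_edges h \<le> m * length ts ^ m)"
proof -
  let ?N = "length ts ^ m + k - 1" and ?M = "m * length ts ^ m"
  \<comment> \<open>The first \<open>k\<close> reveals precede all walks.\<close>
  define I where "I h \<longleftrightarrow> (\<exists>j\<le>k. h = replicate j Revealed) \<or> (\<exists>T x us. position h T x us)" for h
  have bounds: "num_vertices h \<le> ?N \<and> num_edges h \<le> ?M" if "I h" for h
    using that unfolding I_def
  proof
    assume "\<exists>j\<le>k. h = replicate j Revealed"
    moreover have "1 \<le> length ts ^ m" using two_colors by (intro one_le_power) auto
    ultimately show ?thesis by auto
  qed (use position_bounds in blast)
  have "\<exists>\<beta>'. builder_forces (Suc k) (map Suc ts) \<beta>' I"
  proof (rule builder_forces_from_invariant)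
    show "I []" by (auto simp: I_def)
    show "length h \<le> ?N + ?M" if "I h" for h
      using bounds[OF that] by (simp add: length_eq_vertices_plus_edges)
    fix h assume "I h" and nw: "\<not> mono_clique (Suc k) (map Suc ts) h"
    then consider j where "j \<le> k" "h = replicate j Revealed" | T x us where "position h T x us"
      unfolding I_def by blast
    then show "\<exists>mv. legal_move (Suc k) h mv \<and> (\<forall>c<length (map Suc ts). I (h @ [response mv c]))"
    proof cases
      case 1
      have "I (h @ [Revealed])"
      proof (cases "j < k")
        case True
        then show ?thesis
          using 1 unfolding I_def by (intro disjI1 exI[of _ "Suc j"]) (simp add: replicate_append_same)
      next
        case False
        \<comment> \<open>Vertex \<open>k\<close> is the first walker, and no vertex has
          settled.\<close>
        then have "\<exists>x us. position (h @ [Revealed]) Map.empty x us"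
          using 1 by (intro position_at_root) (auto simp: tree_def proper_edges_def)
        then show ?thesis unfolding I_def by blast
      qed
      then show ?thesis using 1 by (intro exI[of _ Reveal]) simp
    next
      case 2
      have x: "\<not> won x" using won_lift[OF 2] nw by blast
      show ?thesis
      proof (cases "\<beta> x")
        case Reveal
        show ?thesis
          using position_Reveal[OF 2 x Reveal] by (intro exI[of _ Reveal]) (simp add: I_def)
      next
        case (Build e)
        show ?thesis
          using position_Build[OF 2 x Build]
          by (intro exI[of _ "Build (insert (num_vertices h - 1) ((!) us ` e))"])
             (simp add: I_def del: legal_move.simps, blast)
      qed
    qed
  qed
  then obtain \<beta>' where "builder_forces (Suc k) (map Suc ts) \<beta>' I" by blast
  then show ?thesis by (intro exI[of _ \<beta>'], elim builder_forces_mono) (rule bounds)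
qed

end

section \<open>Ramsey numbers and the main result\<close>

text \<open>Builder builds every edge until Ramsey's theorem applies.\<close>

lemma builder_can_force:
  assumes "0 < k"
  shows "\<exists>M \<beta>. builder_forces k ts \<beta> (\<lambda>h. num_edges h \<le> M)"
proof -
  obtain N :: nat where N: "partn_lst {..<N} ts k" using ramsey_full by blast
  define edges where "edges h = {e. \<exists>c. Built e c \<in> set h}" for h
  \<comment> \<open>Only the newest vertex may have edges missing, so \<open>Suc N\<close> vertices
    suffice to complete the first \<open>N\<close>. The last conjunct says that no edge is built
    twice, which bounds the cost.\<close>
  define I where "I h \<longleftrightarrow> proper_edges k h \<and> num_vertices h \<le> Suc N \<and>
    (\<forall>e c. Built e c \<in> set h \<longrightarrow> c < length ts) \<and> [{..<num_vertices h - 1}]\<^bsup>k\<^esup> \<subseteq> edges h \<and>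
    num_edges h = card (edges h)" for h
  have fin: "finite ([{..<n}]\<^bsup>k\<^esup>)" for n :: nat
    by (simp add: finite_imp_finite_nsets)
  have sub: "edges h \<subseteq> [{..<num_vertices h}]\<^bsup>k\<^esup>" if "I h" for h
    using that by (auto simp: I_def proper_edges_def edges_def)
  have edges_le: "num_edges h \<le> card ([{..<Suc N}]\<^bsup>k\<^esup>)" if "I h" for h
  proof -
    have "edges h \<subseteq> [{..<Suc N}]\<^bsup>k\<^esup>"
      using sub[OF that] that nsets_mono[of "{..<num_vertices h}" "{..<Suc N}" k] by (auto simp: I_def)
    then show ?thesis using card_mono[OF fin] that by (simp add: I_def)
  qed
  \<comment> \<open>Otherwise all edges on \<open>{..<N}\<close> are built, and their colors form a
    coloring to which the choice of \<open>N\<close> applies.\<close>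
  have not_all: "num_vertices h - 1 < N" if "I h" "\<not> mono_clique k ts h" for h
  proof (rule ccontr)
    assume "\<not> num_vertices h - 1 < N"
    then have n: "N \<le> num_vertices h - 1" by simp
    have "\<exists>c<length ts. Built e c \<in> set h" if "e \<in> [{..<N}]\<^bsup>k\<^esup>" for e
      using that \<open>I h\<close> nsets_mono[of "{..<N}" "{..<num_vertices h - 1}" k] n
      unfolding I_def edges_def by fastforce
    then obtain f where f: "\<And>e. e \<in> [{..<N}]\<^bsup>k\<^esup> \<Longrightarrow> f e < length ts \<and> Built e (f e) \<in> set h"
      by metis
    then have "f \<in> [{..<N}]\<^bsup>k\<^esup> \<rightarrow> {..<length ts}" by auto
    then obtain c S where c: "c < length ts" and S: "S \<in> [{..<N}]\<^bsup>(ts ! c)\<^esup>" "f ` [S]\<^bsup>k\<^esup> \<subseteq> {c}"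
      using N unfolding partn_lst_def monochromatic_def by blast
    have "Built e c \<in> set h" if "e \<in> [S]\<^bsup>k\<^esup>" for e
    proof -
      have "e \<in> [{..<N}]\<^bsup>k\<^esup>" using that S(1) by (auto simp: nsets_def)
      moreover have "f e = c" using that S(2) by auto
      ultimately show ?thesis using f by blast
    qed
    moreover have "S \<in> [{..<num_vertices h}]\<^bsup>(ts ! c)\<^esup>"
      using S(1) n by (auto simp: nsets_def)
    ultimately show False using that(2) c unfolding mono_clique_def by blast
  qed
  have "\<exists>\<beta>. builder_forces k ts \<beta> I"
  proof (rule builder_forces_from_invariant)
    show "I []"
      using \<open>0 < k\<close> by (auto simp: I_def proper_edges_def edges_def nsets_def)
    show "length h \<le> Suc N + card ([{..<Suc N}]\<^bsup>k\<^esup>)" if "I h" for h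
      using edges_le[OF that] that by (simp add: length_eq_vertices_plus_edges I_def)
    fix h assume I: "I h" and nw: "\<not> mono_clique k ts h"
    let ?n = "num_vertices h"
    show "\<exists>mv. legal_move k h mv \<and> (\<forall>c<length ts. I (h @ [response mv c]))"
    proof (cases "\<exists>e. legal_move k h (Build e)")
      case True
      then obtain e where e: "legal_move k h (Build e)" by blast
      have "I (h @ [response (Build e) c])" if "c < length ts" for c
      proof -
        have "edges (h @ [Built e c]) = insert e (edges h)" by (auto simp: edges_def)
        moreover have "e \<notin> edges h" using e by (auto simp: edges_def)
        moreover have "finite (edges h)" using finite_subset[OF sub[OF I] fin] .
        moreover have "proper_edges k (h @ [response (Build e) c])"
          using I e by (intro proper_edges_step) (auto simp: I_def)
        ultimately show ?thesis using I that by (auto simp: I_def)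
      qed
      then show ?thesis using e by blast
    next
      case False
      have built: "e \<in> edges h" if e: "e \<in> [{..<?n}]\<^bsup>k\<^esup>" for e
      proof (cases "?n - 1 \<in> e")
        case True
        then have "1 \<le> ?n" using e by (auto simp: nsets_def)
        then show ?thesis using False True e by (auto simp: edges_def)
      next
        case False
        have "x < ?n - 1" if "x \<in> e" for x
        proof -
          have "x < ?n" "x \<noteq> ?n - 1" using that e False by (auto simp: nsets_def)
          then show ?thesis by linarith
        qed
        then have "e \<in> [{..<?n - 1}]\<^bsup>k\<^esup>" using e by (auto simp: nsets_def)
        then show ?thesis using I by (auto simp: I_def)
      qed
      have legal: "legal_move k h Reveal"
      proof (cases "?n < k")
        case False
        \<comment> \<open>The newest \<open>k\<close> vertices form an edge, which is built since no
          legal \<open>Build\<close> is left.\<close>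
        have "\<exists>e. e \<in> [{..<?n}]\<^bsup>k\<^esup> \<and> ?n - 1 \<in> e"
          using False \<open>0 < k\<close> by (intro exI[of _ "{?n - k..<?n}"]) (auto simp: nsets_def)
        then show ?thesis using built by (fastforce simp: edges_def)
      qed simp
      moreover have "I (h @ [Revealed])"
      proof -
        have "edges (h @ [Revealed]) = edges h" by (simp add: edges_def)
        moreover have "proper_edges k (h @ [Revealed])"
          using proper_edges_step[of k h Reveal] I legal by (simp add: I_def)
        moreover have "Suc ?n \<le> Suc N" using not_all[OF I nw] by simp
        ultimately show ?thesis using I built by (auto simp: I_def)
      qed
      ultimately show ?thesis by (intro exI[of _ Reveal]) simp
    qed
  qed
  then obtain \<beta> where "builder_forces k ts \<beta> I" by blast
  then have "builder_forces k ts \<beta> (\<lambda>h. num_edges h \<le> card ([{..<Suc N}]\<^bsup>k\<^esup>))"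
    by (rule builder_forces_mono) (rule edges_le)
  then show ?thesis by blast
qed


text \<open>The \<open>LEAST\<close> is attained, because some bound can be forced.\<close>

lemma builder_forces_vertex_online_ramsey:
  assumes "0 < k"
  shows "\<exists>\<beta>. builder_forces k ts \<beta> (\<lambda>h. num_edges h \<le> vertex_online_ramsey k ts)"
  unfolding vertex_online_ramsey_def by (rule LeastI_ex[OF builder_can_force[OF assms]])

text \<open>A painter who follows a given coloring of the edges on \<open>{..<N}\<close> still
  loses, and the forced clique lies within these vertices.\<close>

lemma ramsey_number_le:
  assumes f: "builder_forces k ts \<beta> (\<lambda>h. num_vertices h \<le> N)" and "ts \<noteq> []"
  shows "ramsey_number k ts \<le> N"
proof -
  have "partn_lst {..<N} ts k"
    unfolding partn_lst_def
  proof
    fix f assume f: "f \<in> [{..<N}]\<^bsup>k\<^esup> \<rightarrow> {..<length ts}"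
    \<comment> \<open>Outside \<open>{..<N}\<close> the color 0 is a default, valid since
      \<open>ts\<close> is nonempty.\<close>
    define \<pi> :: painter where "\<pi> h e = (if e \<in> [{..<N}]\<^bsup>k\<^esup> then f e else 0)" for h e
    have "painter_strategy (length ts) \<pi>"
      using f \<open>ts \<noteq> []\<close> by (auto simp: painter_strategy_def \<pi>_def)
    then obtain s where s: "mono_clique k ts (play \<beta> \<pi> s)" "num_vertices (play \<beta> \<pi> s) \<le> N"
      using assms(1) unfolding builder_forces_def by blast
    have col: "c = \<pi> [] e" if "Built e c \<in> set (play \<beta> \<pi> s)" for e c
      using that by (induction s) (auto simp: play.simps(2) Let_def \<pi>_def split: move.splits)
    obtain c S where c: "c < length ts" and S: "S \<in> [{..<num_vertices (play \<beta> \<pi> s)}]\<^bsup>(ts ! c)\<^esup>"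
      and e: "\<forall>e \<in> [S]\<^bsup>k\<^esup>. Built e c \<in> set (play \<beta> \<pi> s)"
      using s(1) unfolding mono_clique_def by blast
    have S': "S \<in> [{..<N}]\<^bsup>(ts ! c)\<^esup>" using S s(2) by (auto simp: nsets_def)
    have "f e = c" if "e \<in> [S]\<^bsup>k\<^esup>" for e
    proof -
      have "e \<in> [{..<N}]\<^bsup>k\<^esup>" using that S' by (auto simp: nsets_def)
      then show ?thesis using col[of e c] e that by (simp add: \<pi>_def)
    qed
    then have "monochromatic {..<N} (ts ! c) k f c"
      unfolding monochromatic_def using S' by (intro bexI[of _ S]) auto
    then show "\<exists>i<length ts. monochromatic {..<N} (ts ! i) k f i" using c by blast
  qed
  then show ?thesis unfolding ramsey_number_def by (rule Least_le)
qed

theorem theorem2p1: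
  fixes q k m :: nat and ts :: "nat list"
  assumes "q \<ge> 2" and "length ts = q"
    and "2 \<le> k" and "\<forall>t \<in> set ts. k < t"
    and "m = vertex_online_ramsey (k - 1) (map (\<lambda>t. t - 1) ts)"
  shows "(\<exists>\<beta>. builder_forces k ts \<beta>
             (\<lambda>h. num_vertices h \<le> q ^ m + k - 2 \<and> num_edges h \<le> m * q ^ m))
    \<and> ramsey_number k ts \<le> q ^ m + k - 2
    \<and> real (vertex_online_ramsey k ts) \<le> real q powr (real m + log (real q) (real m))"
proof -
  let ?ts = "map (\<lambda>t. t - 1) ts"
  obtain \<beta> where "builder_forces (k - 1) ?ts \<beta> (\<lambda>h. num_edges h \<le> m)"
    using builder_forces_vertex_online_ramsey[of "k - 1" ?ts] assms(3,5) by auto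
  then interpret forced_game "k - 1" m ?ts \<beta>
    using assms(1-4) by unfold_locales auto
  \<comment> \<open>Truncated subtraction is undone by \<open>Suc\<close>, since every size exceeds
    \<open>k\<close>.\<close>
  have "map Suc ?ts = ts" "Suc (k - 1) = k"
    using assms(3,4) by (auto intro!: map_idI)
  \<comment> \<open>The locale's uniformity is \<open>k - 1\<close>, so its vertex bound reads
    \<open>q ^ m + (k - 1) - 1\<close>.\<close>
  then obtain \<beta>' where \<beta>': "builder_forces k ts \<beta>'
      (\<lambda>h. num_vertices h \<le> q ^ m + k - 2 \<and> num_edges h \<le> m * q ^ m)"
    using builder_forces_Suc assms(2,3) by (auto simp: numeral_2_eq_2)
  have "ramsey_number k ts \<le> q ^ m + k - 2"
    using assms(1,2) by (intro ramsey_number_le[of k ts \<beta>'] builder_forces_mono[OF \<beta>']) auto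
  moreover have "vertex_online_ramsey k ts \<le> m * q ^ m"
    unfolding vertex_online_ramsey_def
    using builder_forces_mono[OF \<beta>', of "\<lambda>h. num_edges h \<le> m * q ^ m"] by (intro Least_le) auto
  then have "real (vertex_online_ramsey k ts) \<le> real (m * q ^ m)" by (rule of_nat_mono)
  \<comment> \<open>As \<open>m\<close> is positive, \<open>q\<close> to the power
    \<open>log q m\<close> is \<open>m\<close>.\<close>
  moreover have "real q powr (real m + log (real q) (real m)) = real (m * q ^ m)"
    using assms(1) m_pos by (simp add: powr_add powr_realpow)
  ultimately show ?thesis using \<beta>' by auto
qed

end
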